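(* Let $X$ be an infinite Tychonoff space and let $G$ be a non-trivial metrizable arc-connected topological group. Then: (i) Player II has a winning Markov strategy in $G_{fin}(\Omega(X),\Omega(X))$ if and only if Player II has a winning Markov strategy in $CFT(C_p(X,G),\mathbf{e})$. (ii) Player II has a winning Markov strategy in $G_{1}(\Omega(X),\Omega(X))$ if and only if Player II has a winning Markov strategy in $SCFT(C_p(X,G),\mathbf{e})$.
   Context: Tychonoff means completely regular Hausdorff. $G$ has identity element $e$; arc-connected means that any two distinct points of $G$ are joined by a topological embedding $[0,1]\hookrightarrow G$. $C_p(X,G)$ is the space of all continuous functions $X\to G$ with the topology of pointwise convergence, and $\mathbf{e}\in C_p(X,G)$ is the constant function with value $e$. An open cover $\mathcal{U}$ of $X$ is an $\omega$-cover if $X\notin\mathcal{U}$ and every finite subset of $X$ is contained in some member of $\mathcal{U}$; $\Omega(X)$ is the collection of all $\omega$-covers of $X$. For a space $Y$ and $y\in Y$, $\Omega_y=\{A\subset Y: y\in\overline{A}\setminus A\}$. For collections $\mathcal{A},\mathcal{B}$ of subsets of an infinite set, the game $G_{fin}(\mathcal{A},\mathcal{B})$ is played in innings $n\in\mathbb{N}=\{1,2,\dots\}$: in inning $n$ Player I selects $A_n\in\mathcal{A}$ and Player II responds with a finite subset $B_n\subset A_n$; Player II wins if $\bigcup_n B_n\in\mathcal{B}$, otherwise Player I wins. The game $G_1(\mathcal{A},\mathcal{B})$ is the same except that Player II responds with a single element $b_n\in A_n$, and Player II wins if $\{b_n:n\in\mathbb{N}\}\in\mathcal{B}$. Set $CFT(Y,y):=G_{fin}(\Omega_y,\Omega_y)$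 and $SCFT(Y,y):=G_1(\Omega_y,\Omega_y)$; thus Player II wins $CFT(Y,y)$ if $y\in\overline{\bigcup_n B_n}$ and wins $SCFT(Y,y)$ if $y\in\overline{\{b_n:n\in\mathbb{N}\}}$. A strategy for Player II is a function $\sigma$ on $\bigcup_{n\ge1}\mathcal{A}^n$ assigning to each $(A_1,\dots,A_n)$ a legal response to $A_n$ (a finite subset of $A_n$, respectively an element of $A_n$); it is winning if, for every sequence $(A_n)_n$ of elements of $\mathcal{A}$ played by Player I, Player II wins by responding with $\sigma(A_1,\dots,A_n)$ in each inning $n$. A strategy $\sigma$ is Markov if there is a function $\tau$ on $\mathcal{A}\times\mathbb{N}$, with $\tau(A,n)$ a finite subset of $A$ (for $G_{fin}$), respectively an element of $A$ (for $G_1$), for all $A\in\mathcal{A}$ and $n\in\mathbb{N}$, such that $\sigma(A_1,\dots,A_n)=\tau(A_n,n)$ for all $(A_1,\dots,A_n)$; that is, the response depends only on Player I's current move and the round number. *)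

theory Defs
  imports "HOL-Analysis.Analysis"
begin

definition Tychonoff_space :: "'a topology \<Rightarrow> bool" where
  "Tychonoff_space X \<longleftrightarrow> completely_regular_space X \<and> Hausdorff_space X"

definition arc_connected_space :: "'a topology \<Rightarrow> bool" where
  "arc_connected_space X \<longleftrightarrow>
     (\<forall>x\<in>topspace X. \<forall>y\<in>topspace X. x \<noteq> y \<longrightarrow>
        (\<exists>g :: real \<Rightarrow> 'a. embedding_map (top_of_set {0..1}) X g \<and> g 0 = x \<and> g 1 = y))"

text \<open>A continuous function on \<open>X\<close> is represented by its extensional representative, that is,
  the one taking the value \<open>undefined\<close> outside \<open>topspace X\<close>.\<close>

definition Cp :: "'a topology \<Rightarrow> 'b topology \<Rightarrow> ('a \<Rightarrow> 'b) topology" where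
  "Cp X Y = subtopology (product_topology (\<lambda>_. Y) (topspace X)) {f. continuous_map X Y f}"

definition Cp_const :: "'a topology \<Rightarrow> 'b \<Rightarrow> 'a \<Rightarrow> 'b" where
  "Cp_const X c = (\<lambda>x\<in>topspace X. c)"

definition omega_covers :: "'a topology \<Rightarrow> 'a set set set" where
  "omega_covers X =
     {\<U>. (\<forall>U\<in>\<U>. openin X U) \<and> \<Union>\<U> = topspace X \<and> topspace X \<notin> \<U> \<and>
          (\<forall>F. finite F \<and> F \<subseteq> topspace X \<longrightarrow> (\<exists>U\<in>\<U>. F \<subseteq> U))}"

definition Omega_at :: "'a topology \<Rightarrow> 'a \<Rightarrow> 'a set set" where
  "Omega_at Y y = {A. A \<subseteq> topspace Y \<and> y \<in> Y closure_of A - A}"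

text \<open>Innings are numbered from \<open>1\<close>. The field \<open>p2_wins\<close> depends on Player II's sequence of
  responses; only its values at indices \<open>n \<ge> 1\<close> are meaningful.\<close>

record ('m, 'r) game =
  p1_moves :: "'m set"
  p2_legal :: "'m \<Rightarrow> 'r \<Rightarrow> bool"
  p2_wins :: "(nat \<Rightarrow> 'r) \<Rightarrow> bool"

definition G_fin :: "'s set set \<Rightarrow> 's set set \<Rightarrow> ('s set, 's set) game" where
  "G_fin \<A> \<B> =
     \<lparr>p1_moves = \<A>,
      p2_legal = (\<lambda>A B. finite B \<and> B \<subseteq> A),
      p2_wins = (\<lambda>b. (\<Union>n\<in>{1..}. b n) \<in> \<B>)\<rparr>"

definition G_1 :: "'s set set \<Rightarrow> 's set set \<Rightarrow> ('s set, 's) game" where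
  "G_1 \<A> \<B> =
     \<lparr>p1_moves = \<A>,
      p2_legal = (\<lambda>A b. b \<in> A),
      p2_wins = (\<lambda>b. b ` {1..} \<in> \<B>)\<rparr>"

definition CFT :: "'a topology \<Rightarrow> 'a \<Rightarrow> ('a set, 'a set) game" where
  "CFT Y y = G_fin (Omega_at Y y) (Omega_at Y y)"

definition SCFT :: "'a topology \<Rightarrow> 'a \<Rightarrow> ('a set, 'a) game" where
  "SCFT Y y = G_1 (Omega_at Y y) (Omega_at Y y)"

text \<open>The list \<open>[A\<^sub>1, \<dots>, A\<^sub>n]\<close> holds Player I's moves in chronological order.\<close>

definition p2_strategy :: "('m, 'r) game \<Rightarrow> ('m list \<Rightarrow> 'r) \<Rightarrow> bool" where
  "p2_strategy \<G> \<sigma> \<longleftrightarrow>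
     (\<forall>As. As \<noteq> [] \<and> set As \<subseteq> p1_moves \<G> \<longrightarrow> p2_legal \<G> (last As) (\<sigma> As))"

definition winning :: "('m, 'r) game \<Rightarrow> ('m list \<Rightarrow> 'r) \<Rightarrow> bool" where
  "winning \<G> \<sigma> \<longleftrightarrow>
     (\<forall>A :: nat \<Rightarrow> 'm. (\<forall>n\<ge>1. A n \<in> p1_moves \<G>) \<longrightarrow>
        p2_wins \<G> (\<lambda>n. \<sigma> (map A [1..<Suc n])))"

definition Markov :: "('m, 'r) game \<Rightarrow> ('m list \<Rightarrow> 'r) \<Rightarrow> bool" where
  "Markov \<G> \<sigma> \<longleftrightarrow>
     (\<exists>\<tau> :: 'm \<Rightarrow> nat \<Rightarrow> 'r.
        (\<forall>A\<in>p1_moves \<G>. \<forall>n\<ge>1. p2_legal \<G> A (\<tau> A n)) \<and>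
        (\<forall>As. As \<noteq> [] \<and> set As \<subseteq> p1_moves \<G> \<longrightarrow> \<sigma> As = \<tau> (last As) (length As)))"

definition p2_has_winning_Markov_strategy :: "('m, 'r) game \<Rightarrow> bool" where
  "p2_has_winning_Markov_strategy \<G> \<longleftrightarrow>
     (\<exists>\<sigma>. p2_strategy \<G> \<sigma> \<and> winning \<G> \<sigma> \<and> Markov \<G> \<sigma>)"

end

theory Submission
  imports Defs
begin

text \<open>Functions and covers are translated into each other inning by inning, so the round number
  and current move suffice for the transferred strategy. Let \<open>V\<^sub>n\<close> be a neighbourhood base at
  \<open>0\<close>. A move \<open>A\<close> clustering at the constant function is turned in inning \<open>n\<close> into the family
  of preimages of \<open>V\<^sub>n\<close> under members of \<open>A\<close>. It is an \<open>\<omega>\<close>-cover unless some preimage is all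
  of \<open>X\<close>; if that happens infinitely often, uniform convergence already wins, and otherwise it is
  harmless to discard finitely many innings. Conversely, an \<open>\<omega>\<close>-cover \<open>\<U>\<close> is turned into
  the set of functions that equal a fixed \<open>d \<noteq> 0\<close> off some member of \<open>\<U>\<close>; complete regularity and
  an arc from \<open>0\<close> to \<open>d\<close> make this set cluster at the constant \<open>0\<close>.\<close>

section \<open>Markov strategies as selections made inning by inning\<close>

text \<open>Both games at once: a response in \<open>G\<^sub>1\<close> is regarded as a singleton.\<close>

definition Markov_selection :: "bool \<Rightarrow> 's set set \<Rightarrow> 's set set \<Rightarrow> bool" where
  "Markov_selection single \<A> \<B> \<longleftrightarrow>
     (\<exists>\<tau> :: 's set \<Rightarrow> nat \<Rightarrow> 's set.
        (\<forall>A\<in>\<A>. \<forall>n\<ge>1. finite (\<tau> A n) \<and> \<tau> A n \<subseteq> A \<and> (single \<longrightarrow> is_singleton (\<tau> A n))) \<and>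
        (\<forall>A. (\<forall>n\<ge>1. A n \<in> \<A>) \<longrightarrow> (\<Union>n\<in>{1..}. \<tau> (A n) n) \<in> \<B>))"

lemma p2_has_winning_Markov_strategy_iff:
  assumes wins_cong: "\<And>b b'. (\<And>n. n \<ge> 1 \<Longrightarrow> b n = b' n) \<Longrightarrow> p2_wins \<G> b = p2_wins \<G> b'"
  shows "p2_has_winning_Markov_strategy \<G> \<longleftrightarrow>
     (\<exists>\<tau>. (\<forall>A\<in>p1_moves \<G>. \<forall>n\<ge>1. p2_legal \<G> A (\<tau> A n)) \<and>
          (\<forall>A. (\<forall>n\<ge>1. A n \<in> p1_moves \<G>) \<longrightarrow> p2_wins \<G> (\<lambda>n. \<tau> (A n) n)))"
    (is "_ \<longleftrightarrow> (\<exists>\<tau>. ?legal \<tau> \<and> ?wins \<tau>)")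
proof
  assume "p2_has_winning_Markov_strategy \<G>"
  then obtain \<sigma> \<tau> where \<sigma>: "winning \<G> \<sigma>" and legal: "?legal \<tau>"
    and \<tau>: "\<And>As. As \<noteq> [] \<Longrightarrow> set As \<subseteq> p1_moves \<G> \<Longrightarrow> \<sigma> As = \<tau> (last As) (length As)"
    unfolding p2_has_winning_Markov_strategy_def Markov_def by blast
  have "p2_wins \<G> (\<lambda>n. \<tau> (A n) n)" if A: "\<forall>n\<ge>1. A n \<in> p1_moves \<G>" for A
  proof -
    \<comment> \<open>For \<open>n \<ge> 1\<close> this history is nonempty, has length
      \<open>n\<close> and ends in \<open>A n\<close>.\<close>
    have "\<sigma> (map A [1..<Suc n]) = \<tau> (A n) n" if "n \<ge> 1" for n
      using that A by (subst \<tau>) (auto simp: last_map)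
    then show ?thesis
      using \<sigma> A wins_cong[of "\<lambda>n. \<sigma> (map A [1..<Suc n])" "\<lambda>n. \<tau> (A n) n"]
      unfolding winning_def by blast
  qed
  with legal show "\<exists>\<tau>. ?legal \<tau> \<and> ?wins \<tau>" by blast
next
  assume "\<exists>\<tau>. ?legal \<tau> \<and> ?wins \<tau>"
  then obtain \<tau> where legal: "?legal \<tau>" and wins: "?wins \<tau>" by blast
  define \<sigma> where "\<sigma> As = \<tau> (last As) (length As)" for As
  have "p2_strategy \<G> \<sigma>"
    unfolding p2_strategy_def \<sigma>_def
  proof (intro allI impI, elim conjE)
    fix As assume As: "As \<noteq> []" "set As \<subseteq> p1_moves \<G>"
    then have "last As \<in> p1_moves \<G>" using last_in_set by blast
    moreover have "length As \<ge> 1" using As(1) by (simp add: Suc_le_eq)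
    ultimately show "p2_legal \<G> (last As) (\<tau> (last As) (length As))"
      using legal by blast
  qed
  moreover have "Markov \<G> \<sigma>"
    using legal unfolding Markov_def \<sigma>_def by blast
  moreover have "winning \<G> \<sigma>"
    unfolding winning_def
  proof (intro allI impI)
    fix A :: "nat \<Rightarrow> _" assume A: "\<forall>n\<ge>1. A n \<in> p1_moves \<G>"
    have "\<sigma> (map A [1..<Suc n]) = \<tau> (A n) n" if "n \<ge> 1" for n
      using that by (simp add: \<sigma>_def last_map)
    then show "p2_wins \<G> (\<lambda>n. \<sigma> (map A [1..<Suc n]))"
      using wins A wins_cong[of "\<lambda>n. \<sigma> (map A [1..<Suc n])" "\<lambda>n. \<tau> (A n) n"] by blast
  qed
  ultimately show "p2_has_winning_Markov_strategy \<G>"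
    unfolding p2_has_winning_Markov_strategy_def by blast
qed

lemma G_fin_Markov_iff:
  "p2_has_winning_Markov_strategy (G_fin \<A> \<B>) \<longleftrightarrow> Markov_selection False \<A> \<B>"
proof (subst p2_has_winning_Markov_strategy_iff)
  fix b b' :: "nat \<Rightarrow> 'a set" assume "\<And>n. n \<ge> 1 \<Longrightarrow> b n = b' n"
  then have "(\<Union>n\<in>{1..}. b n) = (\<Union>n\<in>{1..}. b' n)" by auto
  then show "p2_wins (G_fin \<A> \<B>) b = p2_wins (G_fin \<A> \<B>) b'"
    by (simp add: G_fin_def)
qed (simp add: G_fin_def Markov_selection_def)

text \<open>A response \<open>b\<close> is traded for \<open>{b}\<close>, and
  \<open>the_elem\<close> recovers it. The union of these singletons over all innings is the set of
  responses.\<close>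

lemma G_1_Markov_iff:
  "p2_has_winning_Markov_strategy (G_1 \<A> \<B>) \<longleftrightarrow> Markov_selection True \<A> \<B>"
proof (subst p2_has_winning_Markov_strategy_iff)
  fix b b' :: "nat \<Rightarrow> 'a" assume "\<And>n. n \<ge> 1 \<Longrightarrow> b n = b' n"
  then have "b ` {1..} = b' ` {1..}" by (intro image_cong) auto
  then show "p2_wins (G_1 \<A> \<B>) b = p2_wins (G_1 \<A> \<B>) b'"
    by (simp add: G_1_def)
next
  show "(\<exists>\<tau>. (\<forall>A\<in>p1_moves (G_1 \<A> \<B>). \<forall>n\<ge>1. p2_legal (G_1 \<A> \<B>) A (\<tau> A n)) \<and>
          (\<forall>A. (\<forall>n\<ge>1. A n \<in> p1_moves (G_1 \<A> \<B>)) \<longrightarrow> p2_wins (G_1 \<A> \<B>) (\<lambda>n. \<tau> (A n) n)))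
        \<longleftrightarrow> Markov_selection True \<A> \<B>" (is "?L \<longleftrightarrow> ?R")
  proof
    assume ?L
    then obtain \<tau> :: "_ \<Rightarrow> nat \<Rightarrow> _" where legal: "\<And>A n. A \<in> \<A> \<Longrightarrow> n \<ge> 1 \<Longrightarrow> \<tau> A n \<in> A"
      and wins: "\<And>A. \<forall>n\<ge>1. A n \<in> \<A> \<Longrightarrow> (\<lambda>n. \<tau> (A n) n) ` {1..} \<in> \<B>"
      unfolding G_1_def game.simps by blast
    have "(\<Union>n\<in>{1..}. {\<tau> (A n) n}) \<in> \<B>" if "\<forall>n\<ge>1. A n \<in> \<A>" for A
      using wins[OF that] by (simp add: UNION_singleton_eq_range)
    then show ?R
      unfolding Markov_selection_def using legal
      by (intro exI[of _ "\<lambda>A n. {\<tau> A n}"]) auto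
  next
    assume ?R
    then obtain \<tau> :: "_ \<Rightarrow> nat \<Rightarrow> _" where legal: "\<And>A n. A \<in> \<A> \<Longrightarrow> n \<ge> 1 \<Longrightarrow> \<tau> A n \<subseteq> A \<and> is_singleton (\<tau> A n)"
      and wins: "\<And>A. \<forall>n\<ge>1. A n \<in> \<A> \<Longrightarrow> (\<Union>n\<in>{1..}. \<tau> (A n) n) \<in> \<B>"
      unfolding Markov_selection_def by auto
    have single: "\<tau> A n = {the_elem (\<tau> A n)}" if "A \<in> \<A>" "n \<ge> 1" for A n
      using legal[OF that] by (metis is_singleton_the_elem)
    have "(\<lambda>n. the_elem (\<tau> (A n) n)) ` {1..} \<in> \<B>" if A: "\<forall>n\<ge>1. A n \<in> \<A>" for A
    proof -
      have "(\<Union>n\<in>{1..}. \<tau> (A n) n) = (\<Union>n\<in>{1..}. {the_elem (\<tau> (A n) n)})"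
        using A single by (intro SUP_cong) auto
      then show ?thesis using wins[OF A] by (simp add: UNION_singleton_eq_range)
    qed
    moreover have "the_elem (\<tau> A n) \<in> A" if "A \<in> \<A>" "n \<ge> 1" for A n
      using legal[OF that] single[OF that] by blast
    ultimately show ?L
      by (intro exI[of _ "\<lambda>A n. the_elem (\<tau> A n)"]) (simp add: G_1_def)
  qed
qed

lemma is_singleton_image: "is_singleton A \<Longrightarrow> is_singleton (f ` A)"
  by (auto simp: is_singleton_def)

section \<open>Clustering at a constant function under pointwise convergence\<close>

lemma topspace_Cp:
  "topspace (Cp X Y) = {f \<in> extensional (topspace X). continuous_map X Y f}"
  by (auto simp: Cp_def PiE_def continuous_map_def Pi_iff)

lemma Cp_const_in_topspace: "c \<in> topspace Y \<Longrightarrow> Cp_const X c \<in> topspace (Cp X Y)"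
  unfolding topspace_Cp Cp_const_def
  by (auto intro: continuous_map_eq[of X Y "\<lambda>_. c"])

text \<open>A basic neighbourhood restricts finitely many coordinates, and at a constant function
  all of these restrictions surround the same value \<open>c\<close>. They can therefore be replaced
  by a single open set \<open>W\<close>.\<close>

lemma Omega_at_Cp_const:
  assumes c: "c \<in> topspace Y"
  shows "A \<in> Omega_at (Cp X Y) (Cp_const X c) \<longleftrightarrow>
    A \<subseteq> topspace (Cp X Y) \<and> Cp_const X c \<notin> A \<and>
    (\<forall>F W. finite F \<and> F \<subseteq> topspace X \<and> openin Y W \<and> c \<in> W \<longrightarrow> (\<exists>f\<in>A. f ` F \<subseteq> W))"
proof -
  have "Cp_const X c \<in> Cp X Y closure_of A \<longleftrightarrow>
    (\<forall>F W. finite F \<and> F \<subseteq> topspace X \<and> openin Y W \<and> c \<in> W \<longrightarrow> (\<exists>f\<in>A. f ` F \<subseteq> W))"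
    (is "?L \<longleftrightarrow> ?R") if A: "A \<subseteq> topspace (Cp X Y)"
  proof
    assume L: ?L
    show ?R
    proof (intro allI impI, elim conjE)
      fix F W assume F: "finite F" "F \<subseteq> topspace X" and W: "openin Y W" "c \<in> W"
      \<comment> \<open>The open box that constrains only the coordinates in \<open>F\<close>;
        membership in it forces \<open>F\<close> to be mapped into \<open>W\<close>.\<close>
      define P where "P = (\<Pi>\<^sub>E x\<in>topspace X. if x \<in> F then W else topspace Y)"
      have "openin (product_topology (\<lambda>_. Y) (topspace X)) P"
        unfolding P_def openin_PiE_gen
      proof (intro disjI2 conjI ballI)
        show "finite {x \<in> topspace X. (if x \<in> F then W else topspace Y) \<noteq> topspace Y}"
          by (rule finite_subset[OF _ F(1)]) auto
      qed (use W in auto)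
      then have "openin (Cp X Y) (P \<inter> {f. continuous_map X Y f})"
        unfolding Cp_def openin_subtopology by blast
      moreover have "Cp_const X c \<in> P \<inter> {f. continuous_map X Y f}"
        using c W Cp_const_in_topspace[OF c, of X]
        by (simp add: P_def Cp_const_def topspace_Cp)
      moreover have "\<forall>T. Cp_const X c \<in> T \<and> openin (Cp X Y) T \<longrightarrow> (\<exists>f. f \<in> A \<and> f \<in> T)"
        using L by (simp add: in_closure_of)
      ultimately obtain f where f: "f \<in> A" "f \<in> P" by (meson IntD1)
      have "f ` F \<subseteq> W" using f(2) F(2) by (force simp: P_def PiE_iff)
      with f show "\<exists>f\<in>A. f ` F \<subseteq> W" by blast
    qed
  next
    assume R: ?R
    have "\<exists>f\<in>A. f \<in> T" if T: "openin (Cp X Y) T" "Cp_const X c \<in> T" for T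
    proof -
      obtain T' where T': "openin (product_topology (\<lambda>_. Y) (topspace X)) T'"
        "T = T' \<inter> {f. continuous_map X Y f}"
        using T(1) by (auto simp: Cp_def openin_subtopology)
      have "\<exists>U. finite {x \<in> topspace X. U x \<noteq> topspace Y} \<and> (\<forall>x\<in>topspace X. openin Y (U x)) \<and>
          Cp_const X c \<in> Pi\<^sub>E (topspace X) U \<and> Pi\<^sub>E (topspace X) U \<subseteq> T'"
        by (rule bspec[OF T'(1)[unfolded openin_product_topology_alt]]) (use T(2) T'(2) in blast)
      then obtain U where U: "finite {x \<in> topspace X. U x \<noteq> topspace Y}"
        "\<And>x. x \<in> topspace X \<Longrightarrow> openin Y (U x)"
        "Cp_const X c \<in> Pi\<^sub>E (topspace X) U" "Pi\<^sub>E (topspace X) U \<subseteq> T'"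
        by blast
      define F where "F = {x \<in> topspace X. U x \<noteq> topspace Y}"
      \<comment> \<open>The factor \<open>topspace Y\<close> gives the right set when
        \<open>F\<close> is empty, since the intersection over no indices is
        \<open>UNIV\<close>.\<close>
      define W where "W = topspace Y \<inter> (\<Inter>x\<in>F. U x)"
      have cU: "c \<in> U x" if "x \<in> topspace X" for x
        using U(3) that by (auto simp: Cp_const_def PiE_iff)
      have "openin Y W"
      proof (cases "F = {}")
        case False
        then show ?thesis
          using U(1,2) unfolding W_def
          by (intro openin_Int openin_topspace openin_Inter) (auto simp: F_def)
      qed (simp add: W_def)
      moreover have "c \<in> W" using c cU by (auto simp: W_def F_def)
      ultimately obtain f where f: "f \<in> A" "f ` F \<subseteq> W"
        using R U(1) unfolding F_def by (metis (no_types, lifting) mem_Collect_eq subsetI)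
      have fext: "f \<in> extensional (topspace X)" "continuous_map X Y f"
        using f(1) A by (auto simp: topspace_Cp)
      have "f x \<in> U x" if x: "x \<in> topspace X" for x
      proof (cases "x \<in> F")
        case True then show ?thesis using f(2) by (auto simp: W_def)
      next
        case False
        then have "U x = topspace Y" using x by (simp add: F_def)
        then show ?thesis using fext(2) x by (auto simp: continuous_map_def)
      qed
      then have "f \<in> Pi\<^sub>E (topspace X) U" using fext by (auto simp: PiE_iff)
      then show ?thesis using f(1) U(4) T'(2) fext(2) by blast
    qed
    then show ?L
      using Cp_const_in_topspace[OF c, of X] by (auto simp: in_closure_of)
  qed
  then show ?thesis
    by (cases "Cp_const X c \<in> A") (simp_all add: Omega_at_def cong: conj_cong)
qed

lemma Omega_at_Cp_constD:
  assumes "A \<in> Omega_at (Cp X Y) (Cp_const X c)" and c: "c \<in> topspace Y"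
  shows "A \<subseteq> topspace (Cp X Y)" and "Cp_const X c \<notin> A"
    and "\<lbrakk>finite F; F \<subseteq> topspace X; openin Y W; c \<in> W\<rbrakk> \<Longrightarrow> \<exists>f\<in>A. f ` F \<subseteq> W"
  using assms(1) by (simp_all add: Omega_at_Cp_const[OF c])

lemma Omega_at_Cp_constI:
  assumes "c \<in> topspace Y" "A \<subseteq> topspace (Cp X Y)" "Cp_const X c \<notin> A"
    and "\<And>F W. \<lbrakk>finite F; F \<subseteq> topspace X; openin Y W; c \<in> W\<rbrakk> \<Longrightarrow> \<exists>f\<in>A. f ` F \<subseteq> W"
  shows "A \<in> Omega_at (Cp X Y) (Cp_const X c)"
  using assms by (simp add: Omega_at_Cp_const)

section \<open>Shrinking neighbourhoods and omega-covers\<close>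

text \<open>Balls of radius \<open>1/(n+1)\<close> around \<open>c\<close> decrease, so each
  \<open>W\<close> contains all of them from some index on. This eventual form lets any sufficiently
  late inning serve for \<open>W\<close>.\<close>

lemma metrizable_space_nhds_sequence:
  assumes "metrizable_space Y" and "c \<in> topspace Y"
  obtains V :: "nat \<Rightarrow> 'b set" where "\<And>n. openin Y (V n)" "\<And>n. c \<in> V n"
    "\<And>W. openin Y W \<Longrightarrow> c \<in> W \<Longrightarrow> \<exists>N. \<forall>n\<ge>N. V n \<subseteq> W"
proof -
  obtain M d where "Metric_space M d" and Y: "Y = Metric_space.mtopology M d"
    using assms(1) by (auto simp: metrizable_space_def)
  interpret Metric_space M d by fact
  have c: "c \<in> M" using assms(2) Y by simp
  show thesis
  proof (rule that[of "\<lambda>n. mball c (inverse (real (Suc n)))"])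
    fix W assume "openin Y W" "c \<in> W"
    then obtain r where r: "r > 0" "mball c r \<subseteq> W"
      unfolding Y openin_mtopology by blast
    obtain N where N: "inverse (real (Suc N)) < r"
      using r(1) reals_Archimedean by blast
    have "mball c (inverse (real (Suc n))) \<subseteq> W" if "n \<ge> N" for n
    proof -
      have "inverse (real (Suc n)) \<le> inverse (real (Suc N))"
        using that by (intro le_imp_inverse_le) auto
      then have "mball c (inverse (real (Suc n))) \<subseteq> mball c r"
        using N by (intro mball_subset_concentric) linarith
      then show ?thesis using r(2) by blast
    qed
    then show "\<exists>N. \<forall>n\<ge>N. mball c (inverse (real (Suc n))) \<subseteq> W" by blast
  qed (use c in \<open>auto simp: Y\<close>)
qed

text \<open>Properness of a member is given as a missed point, ready to be added to a finite test
  set.\<close>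

lemma omega_coversD:
  assumes "\<U> \<in> omega_covers X"
  shows "U \<in> \<U> \<Longrightarrow> openin X U" and "U \<in> \<U> \<Longrightarrow> \<exists>x. x \<in> topspace X - U"
    and "finite F \<Longrightarrow> F \<subseteq> topspace X \<Longrightarrow> \<exists>U\<in>\<U>. F \<subseteq> U"
proof -
  show op: "openin X U" if "U \<in> \<U>" for U
    using assms that by (simp add: omega_covers_def)
  show "\<exists>x. x \<in> topspace X - U" if U: "U \<in> \<U>"
  proof -
    have "U \<noteq> topspace X" using assms U by (auto simp: omega_covers_def)
    then show ?thesis using openin_subset[OF op[OF U]] by blast
  qed
  show "\<exists>U\<in>\<U>. F \<subseteq> U" if "finite F" "F \<subseteq> topspace X"
    using assms that by (simp add: omega_covers_def)
qed

text \<open>The union condition is automatic: openness gives one inclusion, singleton test sets the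
  other.\<close>

lemma omega_coversI:
  assumes op: "\<And>U. U \<in> \<U> \<Longrightarrow> openin X U" and proper: "topspace X \<notin> \<U>"
    and ex: "\<And>F. finite F \<Longrightarrow> F \<subseteq> topspace X \<Longrightarrow> \<exists>U\<in>\<U>. F \<subseteq> U"
  shows "\<U> \<in> omega_covers X"
proof -
  have "\<Union>\<U> = topspace X"
  proof
    show "\<Union>\<U> \<subseteq> topspace X" using op by (intro Union_least openin_subset)
    show "topspace X \<subseteq> \<Union>\<U>"
    proof
      fix x assume "x \<in> topspace X"
      then show "x \<in> \<Union>\<U>" using ex[of "{x}"] by auto
    qed
  qed
  then show ?thesis using op proper ex by (simp add: omega_covers_def)
qed

text \<open>A winning selection stays winning after dropping finitely many innings: a finite set meeting
  the complements of the members chosen so far lies only in members chosen later.\<close>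

lemma omega_cover_selection_tail:
  fixes S :: "nat \<Rightarrow> 'a set set"
  assumes win: "(\<Union>n\<in>{1..}. S n) \<in> omega_covers X"
    and fin: "\<And>n. n \<ge> 1 \<Longrightarrow> finite (S n)"
    and F: "finite F" "F \<subseteq> topspace X"
  obtains n U where "n \<ge> M" "n \<ge> 1" "U \<in> S n" "F \<subseteq> U"
proof -
  define K where "K = (\<Union>n\<in>{1..<M}. S n)"
  have "finite K" unfolding K_def using fin by simp
  moreover have "K \<subseteq> (\<Union>n\<in>{1..}. S n)" by (auto simp: K_def)
  ultimately have K: "finite K" "K \<subseteq> (\<Union>n\<in>{1..}. S n)" .
  have "\<exists>p. p \<in> topspace X - U" if "U \<in> K" for U
    using omega_coversD(2)[OF win subsetD[OF K(2) that]] .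
  then obtain p where p: "\<And>U. U \<in> K \<Longrightarrow> p U \<in> topspace X - U" by metis
  have "finite (F \<union> p ` K)" "F \<union> p ` K \<subseteq> topspace X"
    using F K(1) p by auto
  from omega_coversD(3)[OF win this]
  obtain U where U: "U \<in> (\<Union>n\<in>{1..}. S n)" "F \<union> p ` K \<subseteq> U" ..
  then obtain n where n: "n \<ge> 1" "U \<in> S n" by auto
  have "U \<notin> K" using p U(2) by blast
  then have "n \<ge> M" using n by (auto simp: K_def not_le)
  with n U(2) show thesis by (intro that) auto
qed

section \<open>Transfer from omega-covers to sets of functions\<close>

text \<open>If \<open>V n\<close> lies inside \<open>W\<close>, a preimage chosen in inning
  \<open>n\<close> that contains \<open>F\<close> comes from a chosen function mapping
  \<open>F\<close> into \<open>W\<close>. So it is not enough to capture \<open>F\<close> in some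
  inning; this must happen in an inning late enough for \<open>W\<close>.\<close>

lemma Markov_selection_omega_covers_imp_Omega_at:
  fixes X :: "'a topology" and Y :: "'b topology"
  assumes sel: "Markov_selection single (omega_covers X) (omega_covers X)"
    and Y: "metrizable_space Y" and c: "c \<in> topspace Y"
  shows "Markov_selection single (Omega_at (Cp X Y) (Cp_const X c))
           (Omega_at (Cp X Y) (Cp_const X c))"
proof -
  let ?\<Omega> = "Omega_at (Cp X Y) (Cp_const X c)"
  note \<Omega>D = Omega_at_Cp_constD[OF _ c]
  obtain \<tau> :: "'a set set \<Rightarrow> nat \<Rightarrow> 'a set set" where
    legal: "\<forall>A\<in>omega_covers X. \<forall>n\<ge>1.
        finite (\<tau> A n) \<and> \<tau> A n \<subseteq> A \<and> (single \<longrightarrow> is_singleton (\<tau> A n))"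
    and wins: "\<forall>A. (\<forall>n\<ge>1. A n \<in> omega_covers X) \<longrightarrow> (\<Union>n\<in>{1..}. \<tau> (A n) n) \<in> omega_covers X"
    using sel unfolding Markov_selection_def by blast
  note \<tau> = legal[rule_format] and win = wins[THEN spec, THEN mp]
  obtain V :: "nat \<Rightarrow> _" where V: "\<And>n. openin Y (V n)" "\<And>n. c \<in> V n"
    "\<And>W. openin Y W \<Longrightarrow> c \<in> W \<Longrightarrow> \<exists>N. \<forall>n\<ge>N. V n \<subseteq> W"
    using metrizable_space_nhds_sequence[OF Y c] by metis
  define pre where "pre n f = {x \<in> topspace X. f x \<in> V n}" for n :: nat and f
  \<comment> \<open>If the whole space is among the preimages, they do not form an omega-cover and
    \<open>\<tau>\<close> gives no guarantee. The whole space is then chosen itself, as a singleton,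
    which is legal in both games.\<close>
  define S where "S A n = (if topspace X \<in> pre n ` A then {topspace X} else \<tau> (pre n ` A) n)" for A n
  \<comment> \<open>One function is taken back for each chosen preimage, so finite sets stay finite
    and singletons stay singletons.\<close>
  define \<rho> where "\<rho> A n = inv_into A (pre n) ` S A n" for A n
  have cover: "pre n ` A \<in> omega_covers X" if A: "A \<in> ?\<Omega>" and good: "topspace X \<notin> pre n ` A" for A n
  proof -
    have ex: "\<exists>U\<in>pre n ` A. F \<subseteq> U" if F: "finite F" "F \<subseteq> topspace X" for F
    proof -
      obtain f where f: "f \<in> A" "f ` F \<subseteq> V n"
        using \<Omega>D(3)[OF A F V(1,2)] by blast
      then have "F \<subseteq> pre n f" using F by (auto simp: pre_def)
      then show ?thesis using f(1) by blast
    qed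
    have "openin X (pre n f)" if "f \<in> A" for f
    proof -
      have "continuous_map X Y f" using \<Omega>D(1)[OF A] that by (auto simp: topspace_Cp)
      then show ?thesis using V(1) unfolding pre_def by (rule openin_continuous_map_preimage)
    qed
    then show ?thesis using good ex by (intro omega_coversI) auto
  qed
  have S: "finite (S A n)" "S A n \<subseteq> pre n ` A" "single \<longrightarrow> is_singleton (S A n)"
    if "A \<in> ?\<Omega>" "n \<ge> 1" for A n
    using \<tau>[OF cover[OF that(1)] that(2)] by (auto simp: S_def)
  have \<rho>: "finite (\<rho> A n)" "\<rho> A n \<subseteq> A" "single \<longrightarrow> is_singleton (\<rho> A n)"
    if "A \<in> ?\<Omega>" "n \<ge> 1" for A n
    using S[OF that] unfolding \<rho>_def by (auto intro: is_singleton_image inv_into_into)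
  have "(\<Union>n\<in>{1..}. \<rho> (A n) n) \<in> ?\<Omega>" if A: "\<forall>n\<ge>1. A n \<in> ?\<Omega>" for A
  proof -
    have \<rho>A: "\<rho> (A n) n \<subseteq> A n" if "n \<ge> 1" for n
      using \<rho>(2) A that by blast
    have "\<exists>f\<in>(\<Union>n\<in>{1..}. \<rho> (A n) n). f ` F \<subseteq> W"
      if F: "finite F" "F \<subseteq> topspace X" and W: "openin Y W" "c \<in> W" for F W
    proof -
      obtain N where N: "\<And>n. n \<ge> N \<Longrightarrow> V n \<subseteq> W" using V(3)[OF W] by blast
      define bad where "bad = {n. topspace X \<in> pre n ` A n}"
      have "\<exists>n U. n \<ge> N \<and> n \<ge> 1 \<and> U \<in> S (A n) n \<and> F \<subseteq> U"
      proof (cases "finite bad")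
        case False
        \<comment> \<open>\<open>Suc N\<close> rather than \<open>N\<close> also ensures
          \<open>n \<ge> 1\<close>, as innings start at \<open>1\<close>.\<close>
        then obtain n where "n \<ge> Suc N" "n \<in> bad"
          by (meson infinite_nat_iff_unbounded_le)
        then show ?thesis using F(2)
          by (intro exI[of _ n] exI[of _ "topspace X"]) (auto simp: S_def bad_def)
      next
        case True
        then obtain M0 where "\<And>n. n \<in> bad \<Longrightarrow> n < M0"
          by (meson finite_nat_set_iff_bounded)
        \<comment> \<open>From \<open>M\<close> on no inning is bad and \<open>V n\<close> lies in
          \<open>W\<close>; moreover \<open>M \<ge> 1\<close>.\<close>
        define M where "M = max M0 (Suc N)"
        have good: "n \<notin> bad" if "n \<ge> M" for n
          using \<open>\<And>n. n \<in> bad \<Longrightarrow> n < M0\<close>[of n] that by (auto simp: M_def)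
        \<comment> \<open>Innings before \<open>M\<close> may be bad, so they are filled with the
          cover of inning \<open>M\<close> to obtain a legal play against \<open>\<tau>\<close>. Its
          early responses differ from the actual ones, so \<open>F\<close> has to be captured at
          some \<open>n \<ge> M\<close>, where the two plays agree.\<close>
        define C where "C n = (if n \<ge> M then pre n ` A n else pre M ` A M)" for n
        have M1: "M \<ge> 1" "M \<ge> N" by (auto simp: M_def)
        have C: "C n \<in> omega_covers X" for n
        proof -
          have "pre k ` A k \<in> omega_covers X" if "k \<ge> M" for k
            using good[OF that] that M1 A cover[of "A k" k] by (auto simp: bad_def)
          then show ?thesis by (auto simp: C_def)
        qed
        obtain n U where nU: "n \<ge> M" "n \<ge> 1" "U \<in> \<tau> (C n) n" "F \<subseteq> U"
          using omega_cover_selection_tail[of "\<lambda>n. \<tau> (C n) n" X F M] win C \<tau> F by blast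
        then have "U \<in> S (A n) n"
          using good[OF nU(1)] by (auto simp: S_def C_def bad_def)
        then show ?thesis using nU M1 le_trans by blast
      qed
      then obtain n U where n: "n \<ge> N" "n \<ge> 1" and U: "U \<in> S (A n) n" "F \<subseteq> U" by blast
      define f where "f = inv_into (A n) (pre n) U"
      have "U \<in> pre n ` A n" using S(2)[of "A n" n] A n U by blast
      then have "pre n f = U" unfolding f_def by (rule f_inv_into_f)
      then have "f ` F \<subseteq> W" using U(2) N[OF n(1)] by (auto simp: pre_def)
      moreover have "f \<in> \<rho> (A n) n" using U(1) by (simp add: f_def \<rho>_def)
      ultimately show ?thesis using n(2) by auto
    qed
    moreover have "f \<in> topspace (Cp X Y)" "f \<noteq> Cp_const X c"
      if f: "f \<in> (\<Union>n\<in>{1..}. \<rho> (A n) n)" for f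
    proof -
      obtain n where n: "n \<ge> 1" "f \<in> A n" using f \<rho>A by auto
      then have "A n \<in> ?\<Omega>" using A by blast
      from \<Omega>D(1,2)[OF this] n(2)
      show "f \<in> topspace (Cp X Y)" "f \<noteq> Cp_const X c" by blast+
    qed
    ultimately show ?thesis using c by (intro Omega_at_Cp_constI) blast+
  qed
  then show ?thesis
    unfolding Markov_selection_def using \<rho> by (intro exI[of _ \<rho>]) blast
qed

section \<open>Transfer from sets of functions to omega-covers\<close>

text \<open>A function mapping \<open>F\<close> into \<open>W\<^sub>0\<close> avoids the value
  \<open>d\<close> on \<open>F\<close>. If it equals \<open>d\<close> off a member of the cover,
  that member contains \<open>F\<close>. The path \<open>\<gamma>\<close> turns real-valued
  separating functions into maps to \<open>Y\<close>.\<close>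

lemma Markov_selection_Omega_at_imp_omega_covers:
  fixes X :: "'a topology" and Y :: "'b topology"
  assumes sel: "Markov_selection single (Omega_at (Cp X Y) (Cp_const X c))
                  (Omega_at (Cp X Y) (Cp_const X c))"
    and X: "completely_regular_space X"
    and \<gamma>: "continuous_map (top_of_set {0..1::real}) Y \<gamma>" "\<gamma> 0 = c" "\<gamma> 1 = d"
    and W0: "openin Y W\<^sub>0" "c \<in> W\<^sub>0" "d \<notin> W\<^sub>0"
  shows "Markov_selection single (omega_covers X) (omega_covers X)"
proof -
  let ?\<Omega> = "Omega_at (Cp X Y) (Cp_const X c)"
  have c: "c \<in> topspace Y" using openin_subset[OF W0(1)] W0(2) by blast
  note \<Omega>D = Omega_at_Cp_constD[OF _ c]
  obtain \<tau> :: "('a \<Rightarrow> 'b) set \<Rightarrow> nat \<Rightarrow> ('a \<Rightarrow> 'b) set" where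
    legal: "\<forall>A\<in>?\<Omega>. \<forall>n\<ge>1.
        finite (\<tau> A n) \<and> \<tau> A n \<subseteq> A \<and> (single \<longrightarrow> is_singleton (\<tau> A n))"
    and wins: "\<forall>A. (\<forall>n\<ge>1. A n \<in> ?\<Omega>) \<longrightarrow> (\<Union>n\<in>{1..}. \<tau> (A n) n) \<in> ?\<Omega>"
    using sel unfolding Markov_selection_def by blast
  note \<tau> = legal[rule_format] and win = wins[THEN spec, THEN mp]
  define \<Phi> where "\<Phi> \<U> = {f \<in> topspace (Cp X Y). \<exists>U\<in>\<U>. \<forall>x\<in>topspace X - U. f x = d}" for \<U>
  \<comment> \<open>Several members of the cover may witness the same function; one is fixed so that
    a chosen function yields a chosen member.\<close>
  define pick where "pick \<U> f = (SOME U. U \<in> \<U> \<and> (\<forall>x\<in>topspace X - U. f x = d))"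
    for \<U> and f :: "'a \<Rightarrow> 'b"
  define \<rho> where "\<rho> \<U> n = pick \<U> ` \<tau> (\<Phi> \<U>) n" for \<U> n
  have pick: "pick \<U> f \<in> \<U>" "\<And>x. x \<in> topspace X \<Longrightarrow> x \<notin> pick \<U> f \<Longrightarrow> f x = d"
    if "f \<in> \<Phi> \<U>" for \<U> f
  proof -
    have "\<exists>U. U \<in> \<U> \<and> (\<forall>x\<in>topspace X - U. f x = d)" using that by (auto simp: \<Phi>_def)
    from someI_ex[OF this]
    show "pick \<U> f \<in> \<U>" "\<And>x. x \<in> topspace X \<Longrightarrow> x \<notin> pick \<U> f \<Longrightarrow> f x = d"
      unfolding pick_def by blast+
  qed
  have cover: "\<Phi> \<U> \<in> ?\<Omega>" if \<U>: "\<U> \<in> omega_covers X" for \<U>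
  proof -
    \<comment> \<open>Every member of the cover misses some point, where a function in
      \<open>\<Phi> \<U>\<close> takes the value \<open>d\<close>, which differs from
      \<open>c\<close>.\<close>
    have "Cp_const X c \<notin> \<Phi> \<U>"
    proof
      assume "Cp_const X c \<in> \<Phi> \<U>"
      then obtain U where U: "U \<in> \<U>" "\<And>x. x \<in> topspace X - U \<Longrightarrow> Cp_const X c x = d"
        by (auto simp: \<Phi>_def)
      obtain x where x: "x \<in> topspace X - U" using omega_coversD(2)[OF \<U> U(1)] by blast
      then have "c = d" using U(2)[OF x] by (simp add: Cp_const_def)
      then show False using W0 by simp
    qed
    moreover have "\<exists>f\<in>\<Phi> \<U>. f ` F \<subseteq> W"
      if F: "finite F" "F \<subseteq> topspace X" and W: "openin Y W" "c \<in> W" for F W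
    proof -
      obtain U where U: "U \<in> \<U>" "F \<subseteq> U" "openin X U"
        using omega_coversD(1,3)[OF \<U>] F by blast
      have "compactin X F" using F by (simp add: finite_imp_compactin)
      \<comment> \<open>Complete regularity separates the finite, hence compact, set
        \<open>F\<close> from the closed complement of \<open>U\<close>.\<close>
      then obtain g where g: "continuous_map X (top_of_set {0..1::real}) g"
        "g ` F \<subseteq> {0}" "g ` (topspace X - U) \<subseteq> {1}"
        using Urysohn_completely_regular_closed_compact[of 0 1 X "topspace X - U" F] X U
        by (auto simp: disjnt_iff)
      \<comment> \<open>Along the path, \<open>0\<close> becomes \<open>c\<close> on
        \<open>F\<close> and \<open>1\<close> becomes \<open>d\<close> off \<open>U\<close>;
        restriction makes the composite extensional.\<close>
      define f where "f = restrict (\<gamma> \<circ> g) (topspace X)"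
      have "continuous_map X Y f"
        using continuous_map_compose[OF g(1) \<gamma>(1)] unfolding f_def
        by (rule continuous_map_eq) auto
      then have "f \<in> topspace (Cp X Y)" by (simp add: topspace_Cp f_def)
      moreover have "f x = d" if "x \<in> topspace X - U" for x
      proof -
        have "g x = 1" using g(3) that by blast
        then show ?thesis using that \<gamma>(3) by (simp add: f_def)
      qed
      ultimately have "f \<in> \<Phi> \<U>" using U(1) unfolding \<Phi>_def by blast
      moreover have "f x \<in> W" if "x \<in> F" for x
      proof -
        have "g x = 0" "x \<in> topspace X" using g(2) F(2) that by blast+
        then show ?thesis using W(2) \<gamma>(2) by (simp add: f_def)
      qed
      ultimately show ?thesis by blast
    qed
    moreover have "\<Phi> \<U> \<subseteq> topspace (Cp X Y)" by (auto simp: \<Phi>_def)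
    ultimately show ?thesis using c by (intro Omega_at_Cp_constI)
  qed
  have \<rho>: "finite (\<rho> \<U> n)" "\<rho> \<U> n \<subseteq> \<U>" "single \<longrightarrow> is_singleton (\<rho> \<U> n)"
    if "\<U> \<in> omega_covers X" "n \<ge> 1" for \<U> n
    using \<tau>[OF cover[OF that(1)] that(2)] pick(1)[of _ \<U>] unfolding \<rho>_def
    by (auto intro: is_singleton_image)
  have "(\<Union>n\<in>{1..}. \<rho> (A n) n) \<in> omega_covers X" if A: "\<forall>n\<ge>1. A n \<in> omega_covers X" for A
  proof -
    let ?B = "\<Union>n\<in>{1..}. \<rho> (A n) n"
    have "\<forall>n\<ge>1. \<Phi> (A n) \<in> ?\<Omega>" using A cover by blast
    then have in\<Omega>: "(\<Union>n\<in>{1..}. \<tau> (\<Phi> (A n)) n) \<in> ?\<Omega>" by (rule win)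
    have ex: "\<exists>U\<in>?B. F \<subseteq> U" if F: "finite F" "F \<subseteq> topspace X" for F
    proof -
      obtain n f where n: "n \<ge> 1" and f: "f \<in> \<tau> (\<Phi> (A n)) n" "f ` F \<subseteq> W\<^sub>0"
        using \<Omega>D(3)[OF in\<Omega> F W0(1,2)] by auto
      have "f \<in> \<Phi> (A n)" using \<tau> cover A n f(1) by blast
      \<comment> \<open>A point of \<open>F\<close> outside the picked member would be sent to
        \<open>d\<close>, which is not in \<open>W\<^sub>0\<close>.\<close>
      then have "F \<subseteq> pick (A n) f" using pick(2) f(2) W0(3) F(2) by blast
      moreover have "pick (A n) f \<in> \<rho> (A n) n" using f(1) by (simp add: \<rho>_def)
      ultimately show ?thesis using n by auto
    qed
    have sub: "U \<in> A n" if "U \<in> \<rho> (A n) n" "n \<ge> 1" for U n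
      using \<rho>(2) A that by blast
    have proper: "openin X U" "U \<noteq> topspace X" if U: "U \<in> ?B" for U
    proof -
      obtain n where n: "n \<ge> 1" "U \<in> A n" using U sub by auto
      then have \<U>: "A n \<in> omega_covers X" using A by blast
      show "openin X U" by (rule omega_coversD(1)[OF \<U> n(2)])
      show "U \<noteq> topspace X" using omega_coversD(2)[OF \<U> n(2)] by blast
    qed
    show ?thesis
    proof (rule omega_coversI)
      show "topspace X \<notin> ?B" using proper(2) by blast
    qed (use ex proper(1) in blast)+
  qed
  then show ?thesis
    unfolding Markov_selection_def using \<rho> by (intro exI[of _ \<rho>]) blast
qed

section \<open>The two equivalences for the group\<close>

theorem proposition5p1:
  fixes X :: "'a topology"
  assumes "Tychonoff_space X" and "infinite (topspace X)"
    and "\<exists>g :: 'g::topological_group_add. g \<noteq> 0"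
    and "metrizable_space (euclidean :: 'g topology)"
    and "arc_connected_space (euclidean :: 'g topology)"
  shows "(p2_has_winning_Markov_strategy (G_fin (omega_covers X) (omega_covers X)) \<longleftrightarrow>
            p2_has_winning_Markov_strategy
              (CFT (Cp X (euclidean :: 'g topology)) (Cp_const X 0))) \<and>
         (p2_has_winning_Markov_strategy (G_1 (omega_covers X) (omega_covers X)) \<longleftrightarrow>
            p2_has_winning_Markov_strategy
              (SCFT (Cp X (euclidean :: 'g topology)) (Cp_const X 0)))"
proof -
  let ?G = "euclidean :: 'g topology"
  obtain d :: 'g where d: "d \<noteq> 0" using assms(3) by blast
  obtain \<gamma> :: "real \<Rightarrow> 'g" where \<gamma>: "embedding_map (top_of_set {0..1}) ?G \<gamma>" "\<gamma> 0 = 0" "\<gamma> 1 = d"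
    using assms(5) d unfolding arc_connected_space_def by (metis UNIV_I topspace_euclidean)
  have cont_\<gamma>: "continuous_map (top_of_set {0..1}) ?G \<gamma>"
    using \<gamma>(1) homeomorphic_imp_continuous_map continuous_map_in_subtopology
    unfolding embedding_map_def by blast
  have "Hausdorff_space ?G" using assms(4) by (rule metrizable_imp_Hausdorff_space)
  \<comment> \<open>This separation of \<open>0\<close> from \<open>d\<close> supplies the set
    \<open>W\<^sub>0\<close> of the backward transfer.\<close>
  then obtain W where W: "openin ?G W" "0 \<in> W" "d \<notin> W"
    using d unfolding Hausdorff_space_def disjnt_iff by (metis UNIV_I topspace_euclidean)
  \<comment> \<open>Leaving \<open>single\<close> free covers both games: \<open>False\<close> gives
    (i) and \<open>True\<close> gives (ii).\<close>
  have "Markov_selection single (omega_covers X) (omega_covers X) \<longleftrightarrow>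
      Markov_selection single (Omega_at (Cp X ?G) (Cp_const X 0)) (Omega_at (Cp X ?G) (Cp_const X 0))"
    for single
    using Markov_selection_omega_covers_imp_Omega_at[OF _ assms(4)]
      Markov_selection_Omega_at_imp_omega_covers[OF _ _ cont_\<gamma> \<gamma>(2,3) W]
      assms(1) unfolding Tychonoff_space_def by auto
  then show ?thesis
    unfolding CFT_def SCFT_def G_fin_Markov_iff G_1_Markov_iff by blast
qed

end
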